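(* Let $f:\mathbb{R}^d\to\mathbb{R}\cup\{\infty\}$ be $\ell$-smooth, and suppose there is $f^*\in\mathbb{R}$ with $f(x)\ge f^*$ for all $x\in\mathcal{X}$. Let $x_0\in\mathcal{X}$, $\Delta:=f(x_0)-f^*$, and let $\{x_k\}_{k\ge0}$ be generated by $$x_{k+1}=x_k-\gamma_k\nabla f(x_k),\qquad \gamma_k=\int_0^1\frac{dv}{\ell(\|\nabla f(x_k)\|+\|\nabla f(x_k)\|v)}.$$ Then $$f(x_{k+1})\le f(x_k)-\frac{\gamma_k}{4}\|\nabla f(x_k)\|^2\quad\text{for all }k\ge0,$$ and $$\min_{k\in\{0,\dots,T-1\}}\frac{\|\nabla f(x_k)\|^2}{\ell(2\|\nabla f(x_k)\|)}\le\frac{4\Delta}{T}\quad\text{for all integers }T\ge1.$$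
   Context: Norms are Euclidean for vectors and spectral for matrices. For $f:\mathbb{R}^d\to\mathbb{R}\cup\{\infty\}$ put $\mathcal{X}=\{x\in\mathbb{R}^d: f(x)<\infty\}$, assumed to be open and convex. $f$ is $\ell$-smooth if $f$ is twice differentiable on $\mathcal{X}$, $f$ is continuous on the closure of $\mathcal{X}$ (as a map into $\mathbb{R}\cup\{\infty\}$), and $\ell:[0,\infty)\to(0,\infty)$ is a non-decreasing positive locally Lipschitz function such that $\|\nabla^2f(x)\|\le\ell(\|\nabla f(x)\|)$ for all $x\in\mathcal{X}$. (The iteration is well defined: the iterates stay in $\mathcal{X}$.) *)

theory Defs
  imports "HOL-Analysis.Analysis"
begin

text \<open>
  Functions into \<open>\<real> \<union> {\<infinity>}\<close> are modelled as \<open>ereal\<close>-valued functions; the absence of the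
  value \<open>-\<infinity>\<close> is stated as a hypothesis where needed. Derivatives are those of the
  real-valued function \<open>\<lambda>y. real_of_ereal (f y)\<close>, which represents \<open>f\<close> on the set where \<open>f\<close>
  is finite (\<open>real_of_ereal \<infinity> = 0\<close> is never relevant, as that set is assumed to be open).
\<close>

definition effective_domain :: "('a \<Rightarrow> ereal) \<Rightarrow> 'a set" where
  "effective_domain f = {x. f x < \<infinity>}"

definition gradient :: "(real ^ 'n \<Rightarrow> ereal) \<Rightarrow> real ^ 'n \<Rightarrow> real ^ 'n" where
  "gradient f x = (THE g. GDERIV (\<lambda>y. real_of_ereal (f y)) x :> g)"

definition hessian :: "(real ^ 'n \<Rightarrow> ereal) \<Rightarrow> real ^ 'n \<Rightarrow> real ^ 'n ^ 'n" where
  "hessian f x = matrix (frechet_derivative (gradient f) (at x))"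

definition twice_differentiable_on :: "(real ^ 'n \<Rightarrow> ereal) \<Rightarrow> (real ^ 'n) set \<Rightarrow> bool" where
  "twice_differentiable_on f S \<longleftrightarrow>
     (\<forall>x\<in>S. (\<lambda>y. real_of_ereal (f y)) differentiable (at x)) \<and>
     (\<forall>x\<in>S. gradient f differentiable (at x))"

text \<open>
  The library norm on the matrix type \<open>real ^ 'n ^ 'm\<close> is the Frobenius norm, so the spectral
  norm is introduced as the operator norm induced by the Euclidean norm.
\<close>

definition spectral_norm :: "real ^ 'n ^ 'm \<Rightarrow> real" where
  "spectral_norm A = onorm (\<lambda>v. A *v v)"

text \<open>
  A function \<open>[0,\<infinity>) \<rightarrow> (0,\<infinity>)\<close> is modelled by a function on all reals of which only the values
  on \<open>{0..}\<close> are constrained.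
\<close>

definition smoothness_modulus :: "(real \<Rightarrow> real) \<Rightarrow> bool" where
  "smoothness_modulus l \<longleftrightarrow>
     (\<forall>s\<ge>0. 0 < l s) \<and>
     mono_on {0..} l \<and>
     (\<forall>s\<ge>0. \<exists>u>0. \<exists>L. L-lipschitz_on (cball s u \<inter> {0..}) l)"

definition ell_smooth :: "(real \<Rightarrow> real) \<Rightarrow> (real ^ 'n \<Rightarrow> ereal) \<Rightarrow> bool" where
  "ell_smooth l f \<longleftrightarrow>
     smoothness_modulus l \<and>
     twice_differentiable_on f (effective_domain f) \<and>
     continuous_on (closure (effective_domain f)) f \<and>
     (\<forall>x\<in>effective_domain f. spectral_norm (hessian f x) \<le> l (norm (gradient f x)))"

definition step_size :: "(real \<Rightarrow> real) \<Rightarrow> (real ^ 'n \<Rightarrow> ereal) \<Rightarrow> real ^ 'n \<Rightarrow> real" where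
  "step_size l f x =
     integral {0..1} (\<lambda>v. 1 / l (norm (gradient f x) + norm (gradient f x) * v))"

end

theory Submission
  imports Defs
begin

text \<open>
  Fix one iterate \<open>x\<close>, put \<open>g = \<nabla>f(x)\<close>, \<open>G = \<parallel>g\<parallel>\<close>, \<open>h(t) = 1 / l(G + G t)\<close> and
  \<open>p(v) = \<integral>\<^sub>0\<^sup>v h\<close>, so that the step size is \<open>p(1)\<close>. The segment from \<open>x\<close> to the next iterate is
  traversed as \<open>v \<mapsto> x - p(v) g\<close> for \<open>v\<close> in \<open>[0,1]\<close>. This parametrisation slows down exactly as
  much as the curvature bound demands: as long as the gradient has moved by at most \<open>G v\<close>, its norm
  is at most \<open>G + G v\<close>, the Hessian is bounded by \<open>l(G + G v)\<close>, and multiplying by the speed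
  \<open>h(v) G\<close> shows that the gradient moves at rate at most \<open>G\<close>. Hence the bound \<open>G v\<close> sustains itself.

  To turn this into a proof without any theory of differential inequalities, the path is shortened
  by a factor \<open>c < 1\<close>, i.e. \<open>z c v = x - c p(v) g\<close>. Then the gradient moves at rate at most
  \<open>c G < G\<close> whenever the bound holds, and this slack lets the bound survive a little beyond any point
  at which it holds. A continuation argument on \<open>[0,1]\<close> (\<open>interval_continuation\<close>) then gives
  it everywhere (\<open>path_tame\<close>). The same argument keeps the path inside the effective domain: \<open>f\<close>
  decreases along the path, so by continuity on the closure \<open>f\<close> is finite at every limit point.

  Along such a path the derivative of \<open>f\<close> is at most \<open>- c h(v) G\<^sup>2 (1 - v)\<close>. Since \<open>h\<close> is
  nonincreasing, \<open>p(v) \<ge> v h(v)\<close>, and therefore \<open>f(z c v) + c G\<^sup>2 (1 - v/2) p(v)\<close> is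
  nonincreasing in \<open>v\<close> (\<open>descent_along_tame_path\<close>). Evaluating at \<open>v = 1\<close> and letting \<open>c\<close> tend
  to 1, again by continuity of \<open>f\<close> on the closure, yields that the next iterate lies in the effective
  domain and that \<open>f\<close> drops by at least half of step size times \<open>G\<^sup>2\<close>
  (\<open>sufficient_decrease\<close>). The step size is at least \<open>1 / l(2 G)\<close>, so telescoping the
  decrease bounds the sum, hence \<open>T\<close> times the minimum, of \<open>G\<^sup>2 / l(2 G)\<close> over the first
  \<open>T\<close> iterates.
\<close>

section \<open>Continuation along an interval\<close>

text \<open>
  Continuous induction: the infimum of the points where \<open>P\<close> fails would satisfy \<open>P\<close> by the first
  hypothesis and would then have a neighbourhood to its right free of failures by the second.
  The first hypothesis at \<open>w = a\<close> has no predecessors and thus serves as the base case.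
\<close>

lemma interval_continuation:
  fixes P :: "real \<Rightarrow> bool"
  assumes left: "\<And>w. \<lbrakk>a \<le> w; w \<le> b; \<And>v. a \<le> v \<Longrightarrow> v < w \<Longrightarrow> P v\<rbrakk> \<Longrightarrow> P w"
    and right: "\<And>w. \<lbrakk>a \<le> w; w < b; P w\<rbrakk> \<Longrightarrow> \<forall>\<^sub>F v in at w within {a..b}. w < v \<longrightarrow> P v"
    and "w \<in> {a..b}"
  shows "P w"
proof (rule ccontr)
  assume "\<not> P w"
  define B where "B = {v \<in> {a..b}. \<not> P v}"
  define m where "m = Inf B"
  have wB: "w \<in> B" using \<open>\<not> P w\<close> assms(3) by (simp add: B_def)
  have bdd: "bdd_below B" by (rule bdd_belowI[of _ a]) (simp add: B_def)
  have ma: "a \<le> m" unfolding m_def by (rule cInf_greatest) (use wB in \<open>auto simp: B_def\<close>)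
  have mw: "m \<le> w" unfolding m_def by (rule cInf_lower[OF wB bdd])
  have below: "P v" if "a \<le> v" "v < m" for v
    using cInf_lower[OF _ bdd, of v] that mw assms(3) by (force simp: B_def m_def)
  have Pm: "P m" by (rule left) (use ma mw assms(3) below in auto)
  then have "m < w" using mw \<open>\<not> P w\<close> by (cases "m = w") auto
  then obtain d where d: "d > 0" "\<And>v. \<lbrakk>v \<in> {a..b}; v \<noteq> m; dist v m < d; m < v\<rbrakk> \<Longrightarrow> P v"
    using right[OF ma _ Pm] assms(3) unfolding eventually_at by force
  have "m + d \<le> v" if "v \<in> B" for v
  proof (rule ccontr)
    assume "\<not> m + d \<le> v"
    moreover have "m \<le> v" unfolding m_def by (rule cInf_lower[OF that bdd])
    moreover have "v \<noteq> m" using that Pm by (auto simp: B_def)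
    ultimately show False using d(2)[of v] that by (auto simp: B_def dist_real_def)
  qed
  then have "m + d \<le> m" unfolding m_def by (intro cInf_greatest) (use wB in auto)
  with d(1) show False by simp
qed

section \<open>Gradients, Hessians and the smoothness modulus\<close>

text \<open>
  The definite description in the definition of the gradient denotes because a linear functional \<open>D\<close>
  is represented by the vector \<open>adjoint D 1\<close>, and only by it.
\<close>

lemma GDERIV_gradient:
  fixes f :: "real ^ 'n \<Rightarrow> ereal"
  assumes "(\<lambda>y. real_of_ereal (f y)) differentiable (at x)"
  shows "GDERIV (\<lambda>y. real_of_ereal (f y)) x :> gradient f x"
proof -
  let ?F = "\<lambda>y. real_of_ereal (f y)"
  obtain D where D: "(?F has_derivative D) (at x)"
    using assms by (auto simp: differentiable_def)
  have "(\<lambda>h. h \<bullet> adjoint D 1) = D"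
    using adjoint_works[OF has_derivative_linear[OF D], of _ 1] by (simp add: fun_eq_iff)
  then have G: "GDERIV ?F x :> adjoint D 1"
    using D by (simp add: gderiv_def)
  have unique: "g = adjoint D 1" if "GDERIV ?F x :> g" for g
  proof -
    have "(\<lambda>h. h \<bullet> g) = (\<lambda>h. h \<bullet> adjoint D 1)"
      using that G unfolding gderiv_def by (rule has_derivative_unique)
    then show ?thesis
      by (simp add: fun_eq_iff vector_eq_ldot)
  qed
  have "gradient f x = adjoint D 1"
    unfolding gradient_def using G unique by (rule the_equality)
  with G show ?thesis by simp
qed

lemma hessian_derivative_bound:
  fixes f :: "real ^ 'n \<Rightarrow> ereal"
  assumes "gradient f differentiable (at x)"
  shows "norm (frechet_derivative (gradient f) (at x) v) \<le> spectral_norm (hessian f x) * norm v"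
proof -
  let ?D = "frechet_derivative (gradient f) (at x)"
  have D: "(gradient f has_derivative ?D) (at x)"
    using assms by (simp add: frechet_derivative_works)
  have "(\<lambda>v. hessian f x *v v) = ?D"
    unfolding hessian_def by (rule matrix_vector_mul(2)[OF has_derivative_linear[OF D]])
  then have "spectral_norm (hessian f x) = onorm ?D"
    by (simp add: spectral_norm_def)
  then show ?thesis
    using onorm[OF has_derivative_bounded_linear[OF D], of v] by simp
qed

text \<open>
  Continuity is what makes the integrand of the step size integrable and its integral differentiable.
\<close>

lemma smoothness_modulus_continuous:
  assumes "smoothness_modulus l"
  shows "continuous_on {0..} l"
  unfolding continuous_on_eq_continuous_within
proof
  fix s :: real assume s: "s \<in> {0..}"
  then obtain u L where u: "u > 0" and L: "L-lipschitz_on (cball s u \<inter> {0..}) l"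
    using assms by (auto simp: smoothness_modulus_def)
  have "continuous (at s within (cball s u \<inter> {0..})) l"
    by (rule bspec[OF lipschitz_on_continuous_on[OF L, unfolded continuous_on_eq_continuous_within]])
       (use s u in simp)
  moreover have "at s within (cball s u \<inter> {0..}) = at s within {0..}"
    by (rule at_within_nhd[of _ "ball s u"]) (use u in auto)
  ultimately show "continuous (at s within {0..}) l" by simp
qed

section \<open>The path from an iterate to the next\<close>

locale gradient_step =
  fixes f :: "real ^ 'n \<Rightarrow> ereal" and l :: "real \<Rightarrow> real" and x :: "real ^ 'n"
  assumes not_MInfty: "\<And>y. f y \<noteq> -\<infinity>"
    and open_dom: "open (effective_domain f)"
    and smooth: "ell_smooth l f"
    and x_dom: "x \<in> effective_domain f"
begin

abbreviation "F \<equiv> \<lambda>y. real_of_ereal (f y)"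
abbreviation "g \<equiv> gradient f x"
abbreviation "G \<equiv> norm g"
abbreviation "h \<equiv> \<lambda>t. 1 / l (G + G * t)"

definition p :: "real \<Rightarrow> real" where "p v = integral {0..v} h"

lemma f_eq_F: "y \<in> effective_domain f \<Longrightarrow> f y = ereal (F y)"
  using not_MInfty[of y] by (cases "f y") (auto simp: effective_domain_def)

lemma f_le_ereal_iff: "y \<in> effective_domain f \<Longrightarrow> f y \<le> ereal a \<longleftrightarrow> F y \<le> a"
  by (subst f_eq_F) simp_all

lemma modulus: "smoothness_modulus l"
  using smooth by (simp add: ell_smooth_def)

lemma l_pos: "0 \<le> s \<Longrightarrow> 0 < l s"
  using modulus by (simp add: smoothness_modulus_def)

lemma l_mono: "0 \<le> s \<Longrightarrow> s \<le> t \<Longrightarrow> l s \<le> l t"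
  using modulus by (auto simp: smoothness_modulus_def mono_on_def)

lemma h_pos: "0 \<le> t \<Longrightarrow> 0 < h t"
  by (simp add: l_pos)

lemma h_antimono: "0 \<le> s \<Longrightarrow> s \<le> t \<Longrightarrow> h t \<le> h s"
  by (intro divide_left_mono l_mono mult_pos_pos l_pos add_left_mono mult_left_mono) auto

lemma h_continuous: "continuous_on {0..1} h"
proof -
  have "continuous_on {0..1} (\<lambda>t. l (G + G * t))"
    by (rule continuous_on_compose2[OF smoothness_modulus_continuous[OF modulus]])
       (auto intro!: continuous_intros)
  moreover have "l (G + G * t) \<noteq> 0" if "t \<in> {0..1}" for t
    using l_pos[of "G + G * t"] that by simp
  ultimately show ?thesis
    by (intro continuous_on_divide continuous_on_const) auto
qed

lemma p_derivative: "v \<in> {0..1} \<Longrightarrow> (p has_real_derivative h v) (at v within {0..1})"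
  unfolding p_def by (rule integral_has_real_derivative[OF h_continuous])

text \<open>
  The integrand is nonincreasing, so its mean over \<open>[0,v]\<close> is at least its last value. At \<open>v = 1\<close>
  this is the lower bound on the step size; at general \<open>v\<close> it replaces the Chebyshev integral
  inequality for \<open>1 - t\<close> and \<open>h t\<close> in the estimate of the decrease.
\<close>

lemma p_lower: "v \<in> {0..1} \<Longrightarrow> v * h v \<le> p v"
proof -
  assume v: "v \<in> {0..1}"
  have "integral {0..v} (\<lambda>_. h v) \<le> integral {0..v} h"
    by (rule integral_le)
       (use v in \<open>auto intro!: h_antimono integrable_continuous_real
         continuous_on_subset[OF h_continuous]\<close>)
  then show ?thesis using v by (simp add: p_def)
qed

lemma p_1: "p 1 = step_size l f x"
  by (simp add: p_def step_size_def)

lemma p_0: "p 0 = 0"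
  by (simp add: p_def)

definition z :: "real \<Rightarrow> real \<Rightarrow> real ^ 'n" where "z c v = x - (c * p v) *\<^sub>R g"

lemma z_derivative:
  assumes "v \<in> {0..1}"
  shows "(z c has_vector_derivative (- (c * h v)) *\<^sub>R g) (at v within {0..1})"
proof -
  have "((\<lambda>v. (c * p v) *\<^sub>R g) has_vector_derivative (c * h v) *\<^sub>R g) (at v within {0..1})"
    using has_vector_derivative_scaleR[OF DERIV_cmult[OF p_derivative[OF assms]]
        has_vector_derivative_const] by simp
  from has_vector_derivative_diff[OF has_vector_derivative_const[of x] this]
  show ?thesis
    unfolding z_def scaleR_minus_left by simp
qed

lemma z_continuous: "v \<in> {0..1} \<Longrightarrow> (z c \<longlongrightarrow> z c v) (at v within {0..1})"
  using has_vector_derivative_continuous[OF z_derivative] by (simp add: continuous_within)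

lemma F_derivative:
  "y \<in> effective_domain f \<Longrightarrow> (F has_derivative (\<lambda>u. u \<bullet> gradient f y)) (at y)"
  using GDERIV_gradient[of f y] smooth
  by (auto simp: ell_smooth_def twice_differentiable_on_def gderiv_def)

lemma gradient_differentiable: "y \<in> effective_domain f \<Longrightarrow> gradient f differentiable (at y)"
  using smooth by (auto simp: ell_smooth_def twice_differentiable_on_def)

text \<open>
  The invariant of the continuation argument; the gradient bound is linear in \<open>v\<close> because \<open>p\<close> makes
  the gradient move at rate at most \<open>G\<close>.
\<close>

definition tame :: "real \<Rightarrow> real \<Rightarrow> bool" where
  "tame c v \<longleftrightarrow> z c v \<in> effective_domain f \<and> norm (gradient f (z c v) - g) \<le> G * v"

text \<open>
  On the tame part of the path \<open>g \<bullet> \<nabla>f \<ge> G\<^sup>2 (1 - v)\<close> by Cauchy-Schwarz. The function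
  \<open>(1 - v / 2) p v\<close> has derivative \<open>(1 - v / 2) h v - p v / 2\<close>, at most \<open>(1 - v) h v\<close> by \<open>p_lower\<close>;
  so it is a lower bound for the accumulated decrease that equals \<open>p 1 / 2\<close> at \<open>v = 1\<close>.
\<close>

lemma descent_along_tame_path:
  assumes "0 \<le> c" "w \<in> {0..1}" "\<And>v. v \<in> {0..w} \<Longrightarrow> tame c v"
  shows "F (z c w) \<le> F x - c * G\<^sup>2 * ((1 - w / 2) * p w)"
proof -
  define \<Phi> where "\<Phi> = (\<lambda>v. F (z c v) + c * G\<^sup>2 * ((1 - v / 2) * p v))"
  define \<Phi>' where "\<Phi>' = (\<lambda>v. - (c * h v) * (g \<bullet> gradient f (z c v))
      + c * G\<^sup>2 * ((1 - v / 2) * h v - p v / 2))"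
  have d: "(\<Phi> has_real_derivative \<Phi>' v) (at v within {0..1})" if v: "v \<in> {0..w}" for v
  proof -
    have v1: "v \<in> {0..1}" using v assms(2) by auto
    have "(F \<circ> z c has_derivative (\<lambda>u. u \<bullet> gradient f (z c v)) \<circ> (\<lambda>t. t *\<^sub>R ((- (c * h v)) *\<^sub>R g)))
        (at v within {0..1})"
      by (rule diff_chain_within[OF z_derivative[OF v1, unfolded has_vector_derivative_def]
           has_derivative_at_withinI[OF F_derivative]])
         (use assms(3)[OF v] in \<open>simp add: tame_def\<close>)
    then have A: "((\<lambda>v. F (z c v)) has_real_derivative - (c * h v) * (g \<bullet> gradient f (z c v)))
        (at v within {0..1})"
      unfolding has_field_derivative_def o_def by (rule has_derivative_eq_rhs) (simp add: fun_eq_iff)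
    show ?thesis
      unfolding \<Phi>_def \<Phi>'_def
      by (rule derivative_eq_intros A p_derivative[OF v1] refl | simp)+
  qed
  have neg: "\<Phi>' v \<le> 0" if v: "v \<in> {0..w}" for v
  proof -
    have v1: "v \<in> {0..1}" using v assms(2) by auto
    have "\<bar>g \<bullet> (gradient f (z c v) - g)\<bar> \<le> G * norm (gradient f (z c v) - g)"
      by (rule Cauchy_Schwarz_ineq2)
    also have "\<dots> \<le> G * (G * v)"
      using assms(3)[OF v] by (intro mult_left_mono) (auto simp: tame_def)
    finally have "G\<^sup>2 * (1 - v) \<le> g \<bullet> gradient f (z c v)"
      by (simp add: inner_diff_right dot_square_norm power2_eq_square algebra_simps)
    then have 1: "c * h v * (G\<^sup>2 * (1 - v)) \<le> c * h v * (g \<bullet> gradient f (z c v))"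
      using assms(1) h_pos[of v] v by (intro mult_left_mono mult_nonneg_nonneg) auto
    have "(1 - v / 2) * a - b / 2 \<le> (1 - v) * a" if "v * a \<le> b" for a b :: real
      using that by (simp add: algebra_simps)
    from this[OF p_lower[OF v1]]
    have 2: "c * G\<^sup>2 * ((1 - v / 2) * h v - p v / 2) \<le> c * G\<^sup>2 * ((1 - v) * h v)"
      by (rule mult_left_mono) (use assms(1) in auto)
    from 1 2 show ?thesis unfolding \<Phi>'_def by (simp add: mult_ac)
  qed
  have "\<Phi> w \<le> \<Phi> 0"
  proof (rule DERIV_nonpos_imp_decreasing_open[of 0 w \<Phi>])
    show "0 \<le> w" using assms(2) by simp
    show "\<exists>y. DERIV \<Phi> v :> y \<and> y \<le> 0" if "0 < v" "v < w" for v
      using d[of v] neg[of v] that assms(2) by (auto simp: at_within_Icc_at)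
    show "continuous_on {0..w} \<Phi>"
      unfolding continuous_on_eq_continuous_within
    proof
      fix v assume v: "v \<in> {0..w}"
      show "continuous (at v within {0..w}) \<Phi>"
        by (rule continuous_within_subset[OF DERIV_continuous[OF d[OF v]]]) (use assms(2) in auto)
    qed
  qed
  then show ?thesis by (simp add: \<Phi>_def z_def p_0)
qed

text \<open>
  The requirement \<open>0 < G\<close> makes the slack \<open>(1 - c) G\<close> between the rate of change of the gradient
  and the growth of its bound positive; that slack absorbs the error of the linear approximation of
  the gradient at the current point, which is all that is available since the Hessian need not be
  continuous.
\<close>

lemma path_tame:
  assumes c: "0 \<le> c" "c < 1" and G: "0 < G" and "w \<in> {0..1}"
  shows "tame c w"
proof (rule interval_continuation[OF _ _ assms(4)])
  fix w :: real
  assume w: "0 \<le> w" "w \<le> 1" and prev: "\<And>v. 0 \<le> v \<Longrightarrow> v < w \<Longrightarrow> tame c v"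
  show "tame c w"
  proof (cases "w = 0")
    case True
    then show ?thesis using x_dom by (simp add: tame_def z_def p_0)
  next
    case False
    with w have w0: "0 < w" by simp
    let ?L = "at w within {0..<w}"
    \<comment> \<open>Both conditions pass to the limit from the left: first membership in the domain, because
      \<open>f \<le> f x\<close> along the path, then the gradient bound, because the gradient is continuous there.\<close>
    have nontriv: "?L \<noteq> bot"
      using w0 by (simp add: at_within_eq_bot_iff)
    have ev: "\<forall>\<^sub>F v in ?L. v \<in> {0..<w}"
      by (simp add: eventually_at_filter)
    have zlim: "(z c \<longlongrightarrow> z c w) ?L"
      by (rule tendsto_mono[OF at_le z_continuous]) (use w in auto)
    have zdom: "z c v \<in> effective_domain f" if "v \<in> {0..<w}" for v
      using prev[of v] that by (auto simp: tame_def)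
    have cl: "z c w \<in> closure (effective_domain f)"
      by (rule Lim_in_closed_set[OF closed_closure _ nontriv zlim])
         (rule eventually_mono[OF ev], use zdom closure_subset in blast)
    have flim: "((\<lambda>v. f (z c v)) \<longlongrightarrow> f (z c w)) ?L"
      by (rule continuous_on_tendsto_compose[OF _ zlim cl])
         (use smooth ev zdom closure_subset in \<open>auto simp: ell_smooth_def elim!: eventually_mono\<close>)
    have "f (z c w) \<le> f x"
    proof (rule tendsto_upperbound[OF flim _ nontriv], rule eventually_mono[OF ev])
      fix v assume v: "v \<in> {0..<w}"
      have "F (z c v) \<le> F x - c * G\<^sup>2 * ((1 - v / 2) * p v)"
        by (rule descent_along_tame_path) (use c v w prev in auto)
      moreover have "0 \<le> p v"
        using p_lower[of v] h_pos[of v] v w by (smt (verit) atLeastAtMost_iff atLeastLessThan_iff mult_nonneg_nonneg)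
      ultimately have "F (z c v) \<le> F x"
        using c v w by (smt (verit) atLeastLessThan_iff field_sum_of_halves mult_nonneg_nonneg zero_le_power2)
      then show "f (z c v) \<le> f x"
        by (subst f_eq_F[OF x_dom]) (simp add: f_le_ereal_iff zdom[OF v])
    qed
    then have zw: "z c w \<in> effective_domain f"
      using x_dom by (auto simp: effective_domain_def)
    have "((\<lambda>v. norm (gradient f (z c v) - g)) \<longlongrightarrow> norm (gradient f (z c w) - g)) ?L"
      using differentiable_imp_continuous_within[OF gradient_differentiable[OF zw]]
      by (intro tendsto_intros isCont_tendsto_compose[OF _ zlim])
    moreover have "((\<lambda>v. G * v) \<longlongrightarrow> G * w) ?L"
      by (intro tendsto_intros)
    moreover have "\<forall>\<^sub>F v in ?L. norm (gradient f (z c v) - g) \<le> G * v"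
      by (rule eventually_mono[OF ev]) (use prev in \<open>auto simp: tame_def\<close>)
    ultimately have "norm (gradient f (z c w) - g) \<le> G * w"
      by (intro tendsto_le[OF nontriv])
    with zw show ?thesis by (simp add: tame_def)
  qed
next
  fix w :: real
  assume w: "0 \<le> w" "w < 1" and tame: "tame c w"
  let ?D = "frechet_derivative (gradient f) (at (z c w))"
  let ?e = "(- (c * h w)) *\<^sub>R g"
  have zw: "z c w \<in> effective_domain f" and bound: "norm (gradient f (z c w) - g) \<le> G * w"
    using tame by (auto simp: tame_def)
  have w1: "w \<in> {0..1}" using w by simp
  \<comment> \<open>Extension to the right: the gradient moves at rate at most \<open>c * G\<close> at \<open>w\<close>.\<close>
  have ev1: "\<forall>\<^sub>F v in at w within {0..1}. z c v \<in> effective_domain f"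
    by (rule topological_tendstoD[OF z_continuous[OF w1] open_dom zw])
  have D: "(gradient f has_derivative ?D) (at (z c w))"
    using gradient_differentiable[OF zw] by (simp add: frechet_derivative_works)
  have "(gradient f \<circ> z c has_derivative ?D \<circ> (\<lambda>t. t *\<^sub>R ?e)) (at w within {0..1})"
    by (rule diff_chain_within[OF z_derivative[OF w1, unfolded has_vector_derivative_def]
         has_derivative_at_withinI[OF D]])
  moreover have "?D \<circ> (\<lambda>t. t *\<^sub>R ?e) = (\<lambda>t. t *\<^sub>R ?D ?e)"
    by (rule ext) (simp only: o_def linear_scale[OF has_derivative_linear[OF D]])
  ultimately have "((\<lambda>v. gradient f (z c v)) has_derivative (\<lambda>t. t *\<^sub>R ?D ?e)) (at w within {0..1})"
    by (simp add: o_def)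
  moreover have "0 < (1 - c) * G" using c G by simp
  ultimately have ev2: "\<forall>\<^sub>F v in at w within {0..1}.
      norm (gradient f (z c v) - gradient f (z c w) - (v - w) *\<^sub>R ?D ?e) \<le> (1 - c) * G * norm (v - w)"
    unfolding has_derivative_within_alt2 by blast
  have "norm (gradient f (z c w)) \<le> G + G * w"
    using bound norm_triangle_sub[of "gradient f (z c w)" g] by linarith
  then have "spectral_norm (hessian f (z c w)) \<le> l (G + G * w)"
    using smooth zw l_mono[of "norm (gradient f (z c w))" "G + G * w"]
    by (force simp: ell_smooth_def)
  then have "norm (?D ?e) \<le> l (G + G * w) * norm ?e"
    by (rule order_trans[OF hessian_derivative_bound[OF gradient_differentiable[OF zw]] mult_right_mono])
       simp
  also have "\<dots> = c * G"
    using c l_pos[of "G + G * w"] w by (simp add: abs_mult)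
  finally have speed: "norm (?D ?e) \<le> c * G" .
  show "\<forall>\<^sub>F v in at w within {0..1}. w < v \<longrightarrow> tame c v"
    using ev1 ev2
  proof eventually_elim
    case (elim v)
    show ?case
    proof
      assume wv: "w < v"
      have split: "norm (a - g) \<le> norm (a - b - d) + norm d + norm (b - g)" for a b d :: "real ^ 'n"
        by norm
      have "norm (gradient f (z c v) - g) \<le>
          norm (gradient f (z c v) - gradient f (z c w) - (v - w) *\<^sub>R ?D ?e)
          + norm ((v - w) *\<^sub>R ?D ?e) + norm (gradient f (z c w) - g)"
        by (rule split)
      also have "\<dots> \<le> (1 - c) * G * (v - w) + (v - w) * (c * G) + G * w"
        using elim(2) wv speed bound by (intro add_mono) (auto intro!: mult_left_mono)
      also have "\<dots> = G * v" by (simp add: algebra_simps)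
      finally show "tame c v" using elim(1) by (simp add: tame_def)
    qed
  qed
qed

section \<open>Decrease in one step\<close>

lemma step_size_lower: "1 / l (2 * G) \<le> step_size l f x"
  using p_lower[of 1] by (simp add: p_1)

lemma step_size_nonneg: "0 \<le> step_size l f x"
  using step_size_lower l_pos[of "2 * G"] by (smt (verit) norm_ge_zero zero_le_divide_1_iff)

text \<open>
  For \<open>c < 1\<close> the end point of the shortened path lies in the domain with the required decrease; the
  limit as \<open>c\<close> tends to 1 is a priori only in the closure of the domain, which is where continuity of
  \<open>f\<close> as an extended-valued function is used.
\<close>

lemma sufficient_decrease_ereal:
  "f (x - step_size l f x *\<^sub>R g) \<le> ereal (F x - step_size l f x / 2 * G\<^sup>2)"
proof (cases "g = 0")
  case True
  then show ?thesis by (simp add: f_le_ereal_iff x_dom)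
next
  case False
  let ?s = "step_size l f x"
  let ?L = "at_left (1::real)"
  have ev: "\<forall>\<^sub>F c in ?L. c \<in> {0<..<1}"
    by (rule eventually_at_leftI[of 0]) auto
  have dom: "z c 1 \<in> effective_domain f" if "c \<in> {0<..<1}" for c
    using path_tame[of c 1] that False by (simp add: tame_def)
  have zlim: "((\<lambda>c. z c 1) \<longlongrightarrow> x - ?s *\<^sub>R g) ?L"
    unfolding z_def p_1 by (auto intro!: tendsto_eq_intros)
  have cl: "x - ?s *\<^sub>R g \<in> closure (effective_domain f)"
    by (rule Lim_in_closed_set[OF closed_closure _ trivial_limit_at_left_real zlim])
       (rule eventually_mono[OF ev], use dom closure_subset in blast)
  have flim: "((\<lambda>c. f (z c 1)) \<longlongrightarrow> f (x - ?s *\<^sub>R g)) ?L"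
    by (rule continuous_on_tendsto_compose[OF _ zlim cl])
       (use smooth ev dom closure_subset in \<open>auto simp: ell_smooth_def elim!: eventually_mono\<close>)
  have blim: "((\<lambda>c. ereal (F x - c * G\<^sup>2 * (?s / 2))) \<longlongrightarrow> ereal (F x - ?s / 2 * G\<^sup>2)) ?L"
    by (auto intro!: tendsto_eq_intros)
  show ?thesis
  proof (rule tendsto_le[OF trivial_limit_at_left_real blim flim], rule eventually_mono[OF ev])
    fix c :: real assume c: "c \<in> {0<..<1}"
    have "F (z c 1) \<le> F x - c * G\<^sup>2 * ((1 - 1 / 2) * p 1)"
      by (rule descent_along_tame_path) (use c False path_tame in auto)
    then show "f (z c 1) \<le> ereal (F x - c * G\<^sup>2 * (?s / 2))"
      by (simp add: p_1 f_le_ereal_iff dom[OF c])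
  qed
qed

text \<open>
  The extended-valued inequality already contains that the next iterate lies in the domain, because
  its right-hand side is finite.
\<close>

lemma sufficient_decrease:
  "x - step_size l f x *\<^sub>R g \<in> effective_domain f"
  "F (x - step_size l f x *\<^sub>R g) \<le> F x - step_size l f x / 2 * G\<^sup>2"
proof -
  show dom: "x - step_size l f x *\<^sub>R g \<in> effective_domain f"
    using sufficient_decrease_ereal by (auto simp: effective_domain_def le_less_trans)
  show "F (x - step_size l f x *\<^sub>R g) \<le> F x - step_size l f x / 2 * G\<^sup>2"
    using sufficient_decrease_ereal f_le_ereal_iff[OF dom] by simp
qed

end

section \<open>Convergence of gradient descent\<close>

theorem theorem5p1:
  fixes f :: "real ^ 'n \<Rightarrow> ereal"
    and l :: "real \<Rightarrow> real"
    and fstar \<Delta> :: real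
    and x :: "nat \<Rightarrow> real ^ 'n"
    and \<gamma> :: "nat \<Rightarrow> real"
  assumes "\<And>y. f y \<noteq> -\<infinity>"
    and "open (effective_domain f)"
    and "convex (effective_domain f)"
    and "ell_smooth l f"
    and "\<And>y. y \<in> effective_domain f \<Longrightarrow> ereal fstar \<le> f y"
    and "x 0 \<in> effective_domain f"
    and "\<Delta> = real_of_ereal (f (x 0)) - fstar"
    and "\<And>k. \<gamma> k = step_size l f (x k)"
    and "\<And>k. x (Suc k) = x k - \<gamma> k *\<^sub>R gradient f (x k)"
  shows "(\<forall>k. f (x (Suc k)) \<le> f (x k) - ereal (\<gamma> k / 4 * (norm (gradient f (x k)))\<^sup>2)) \<and>
         (\<forall>T\<ge>1. (MIN k\<in>{0..<T}. (norm (gradient f (x k)))\<^sup>2 / l (2 * norm (gradient f (x k))))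
                  \<le> 4 * \<Delta> / real T)"
proof -
  let ?F = "\<lambda>y. real_of_ereal (f y)"
  let ?G = "\<lambda>k. norm (gradient f (x k))"
  let ?q = "\<lambda>k. (?G k)\<^sup>2 / l (2 * ?G k)"
  have stepI: "gradient_step f l (x k)" if "x k \<in> effective_domain f" for k
    using assms(1,2,4) that by unfold_locales
  have dom: "x k \<in> effective_domain f" for k
  proof (induction k)
    case (Suc k)
    then show ?case
      using gradient_step.sufficient_decrease(1)[OF stepI] assms(8,9) by simp
  qed (rule assms(6))
  note step = stepI[OF dom]
  have eq: "f (x k) = ereal (?F (x k))" for k
    by (rule gradient_step.f_eq_F[OF step dom])
  have pos: "0 \<le> \<gamma> k * (?G k)\<^sup>2" for k
    using gradient_step.step_size_nonneg[OF step] assms(8) by simp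
  \<comment> \<open>A single step yields the factor 1/2; as the step size is nonnegative, 1/4 follows.\<close>
  have dec: "?F (x (Suc k)) \<le> ?F (x k) - \<gamma> k / 4 * (?G k)\<^sup>2" for k
    using gradient_step.sufficient_decrease(2)[OF step, of k] pos[of k] assms(8,9) by simp
  have q: "?q k \<le> 4 * (?F (x k) - ?F (x (Suc k)))" for k
  proof -
    have "?q k = (?G k)\<^sup>2 * (1 / l (2 * ?G k))" by simp
    also have "\<dots> \<le> (?G k)\<^sup>2 * \<gamma> k"
      using gradient_step.step_size_lower[OF step, of k] assms(8) by (intro mult_left_mono) auto
    finally show ?thesis using dec[of k] by (simp add: field_simps)
  qed
  have "(MIN k\<in>{0..<T}. ?q k) \<le> 4 * \<Delta> / real T" if T: "T \<ge> 1" for T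
  proof -
    let ?m = "MIN k\<in>{0..<T}. ?q k"
    have "real T * ?m = (\<Sum>k\<in>{0..<T}. ?m)" by simp
    also have "\<dots> \<le> (\<Sum>k\<in>{0..<T}. ?q k)" by (intro sum_mono Min_le) auto
    also have "\<dots> \<le> (\<Sum>k\<in>{0..<T}. 4 * (?F (x k) - ?F (x (Suc k))))" by (intro sum_mono q)
    also have "\<dots> = 4 * (?F (x 0) - ?F (x T))"
      by (simp only: sum_distrib_left[symmetric] atLeast0LessThan
          sum_lessThan_telescope'[of "\<lambda>k. ?F (x k)"])
    also have "\<dots> \<le> 4 * \<Delta>"
      using assms(5)[OF dom[of T]] assms(7) by (subst (asm) eq) simp
    finally show ?thesis using T by (simp add: field_simps)
  qed
  moreover have "f (x (Suc k)) \<le> f (x k) - ereal (\<gamma> k / 4 * (?G k)\<^sup>2)" for k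
    using dec[of k] by (subst eq, subst (2) eq) simp
  ultimately show ?thesis by blast
qed

end
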